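(* For $n=0,1,2,\ldots$ let $P_n(x):=\sum_{k=0}^n\binom{2k}k^2\binom{2(n-k)}{n-k}x^{n-k}$. Then $$\sum_{n=0}^\infty\frac n{128^n}\binom{2n}nP_n(4)=\frac{\sqrt2}{\pi},\qquad \sum_{n=0}^\infty\frac{8n+1}{576^n}\binom{2n}nP_n(4)=\frac 9{2\pi},\qquad \sum_{n=0}^\infty\frac{8n+1}{(-4032)^n}\binom{2n}nP_n(4)=\frac{9\sqrt7}{8\pi}.$$ *)

theory Defs
  imports "HOL-Analysis.Analysis"
begin

definition P :: "nat \<Rightarrow> real \<Rightarrow> real" where
  "P n x = (\<Sum>k=0..n. real ((2 * k) choose k) ^ 2 * real ((2 * (n - k)) choose (n - k)) * x ^ (n - k))"

end

theory Submission
  imports Defs "HOL-Real_Asymp.Real_Asymp"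
begin

text \<open>
  Write \<open>W n\<close> for the central binomial coefficient divided by \<open>4 ^ n\<close>. Two applications of Vandermonde's
  identity give \<open>P n 4 / 16 ^ n = (\<Sum>k\<le>n. (n choose k) * (- 1) ^ k * W k ^ 2)\<close>, so the generating
  function of \<open>(2 n choose n) * P n 4 / 64 ^ n\<close> at \<open>y\<close> is \<open>1 / sqrt (1 - y)\<close> times that of \<open>W n ^ 3\<close> at
  \<open>- y / (1 - y)\<close>. The arguments \<open>y = 1/2, 1/9, -1/63\<close> become \<open>-1, -1/8, 1/64\<close>, and differentiating the
  identity turns the three claims into the series of Bauer and Ramanujan
  \<open>\<Sum> (4 n + 1) (-1) ^ n W n ^ 3 = 2 / pi\<close>, \<open>\<Sum> (6 n + 1) (-1/8) ^ n W n ^ 3 = 2 sqrt 2 / pi\<close> and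
  \<open>\<Sum> (42 n + 5) (1/64) ^ n W n ^ 3 = 16 / pi\<close>; at \<open>y = 1/2\<close> the transformed series lies on the
  boundary of its disc of convergence and Abel's limit theorem is used. The classical series
  come from Wilf-Zeilberger pairs with an additional parameter \<open>k\<close>: as \<open>k\<close> tends to infinity only the term
  \<open>n = 0\<close> survives, and its limit is given by Wallis' product.
\<close>

subsection \<open>Normalised central binomial coefficients\<close>

text \<open>The Pochhammer form has rational ratios of consecutive terms and is, up to sign, the
  binomial coefficient with upper entry \<open>- 1/2\<close>.\<close>

definition W :: "nat \<Rightarrow> real" where
  "W n = pochhammer (1/2) n / fact n"

lemma W_0 [simp]: "W 0 = 1"
  by (simp add: W_def)

lemma W_Suc: "W (Suc n) = W n * ((real n + 1/2) / (real n + 1))"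
  by (simp add: W_def pochhammer_Suc divide_simps) (simp add: algebra_simps)

lemma W_pos: "W n > 0"
  by (simp add: W_def pochhammer_pos)

lemma W_antimono: "m \<le> n \<Longrightarrow> W n \<le> W m"
proof (induction n rule: dec_induct)
  case (step n)
  have "W (Suc n) \<le> W n * 1"
    unfolding W_Suc by (intro mult_left_mono) (auto simp: W_pos less_imp_le)
  with step show ?case by simp
qed auto

lemma W_le_1: "W n \<le> 1"
  using W_antimono[of 0 n] by simp

lemma central_binomial_eq_W: "real ((2 * n) choose n) = 4 ^ n * W n"
proof -
  have "fact (2 * n) = (4 ^ n * pochhammer (1/2) n * fact n :: real)"
    using fact_double[of n, where ?'a = real] by (simp add: power_mult)
  then show ?thesis
    by (simp add: W_def binomial_fact mult_2)
qed

text \<open>Both sides start at 1 and gain the factor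
  \<open>(2 n + 1) (2 n + 3) / (4 (n + 1) ^ 2)\<close>, since \<open>4 (n + 1) ^ 2 - 1\<close>
  splits. Every \<open>pi\<close> in the three evaluations enters through this product.\<close>

lemma W_square_wallis:
  "(2 * real n + 1) * W n ^ 2 = inverse (\<Prod>k=1..n. (4 * real k ^ 2) / (4 * real k ^ 2 - 1))"
proof (induction n)
  case (Suc n)
  have *: "inverse ((4 * real (Suc n) ^ 2) / (4 * real (Suc n) ^ 2 - 1))
      = (2 * real n + 3) * (2 * real n + 1) / (4 * (real n + 1) ^ 2)"
    by (simp add: power2_eq_square algebra_simps)
  have "(2 * real (Suc n) + 1) * W (Suc n) ^ 2
      = ((2 * real n + 1) * W n ^ 2) * ((2 * real n + 3) * (2 * real n + 1) / (4 * (real n + 1) ^ 2))"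
    by (simp add: W_Suc power2_eq_square divide_simps) algebra
  moreover have "(\<Prod>k=1..Suc n. (4 * real k ^ 2) / (4 * real k ^ 2 - 1))
      = (\<Prod>k=1..n. (4 * real k ^ 2) / (4 * real k ^ 2 - 1))
        * ((4 * real (Suc n) ^ 2) / (4 * real (Suc n) ^ 2 - 1))"
    by simp
  ultimately show ?case
    by (simp only: Suc.IH * inverse_mult_distrib)
qed auto

lemma W_square_limit: "(\<lambda>n. (2 * real n + 1) * W n ^ 2) \<longlonglongrightarrow> 2 / pi"
  unfolding W_square_wallis using tendsto_inverse[OF wallis] by simp

text \<open>The values \<open>(2 n + 1) * W n ^ 2\<close> decrease from 1, as
  \<open>(2 n + 1) (2 n + 3)\<close> is less than \<open>(2 n + 2) ^ 2\<close>.\<close>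

lemma W_square_bound: "W n ^ 2 \<le> 1 / (2 * real n + 1)"
proof -
  have "(2 * real n + 1) * W n ^ 2 \<le> 1"
  proof (induction n)
    case (Suc n)
    have "(2 * real (Suc n) + 1) * W (Suc n) ^ 2
      = ((2 * real n + 1) * W n ^ 2) * ((2 * real n + 3) * (2 * real n + 1) / (2 * real n + 2) ^ 2)"
      by (simp add: W_Suc power2_eq_square divide_simps) algebra
    also have "(2 * real n + 3) * (2 * real n + 1) / (2 * real n + 2) ^ 2 \<le> 1"
      by (subst divide_le_eq_1_pos, simp) (simp add: power2_eq_square algebra_simps)
    then have "((2 * real n + 1) * W n ^ 2) * ((2 * real n + 3) * (2 * real n + 1) / (2 * real n + 2) ^ 2) \<le> 1 * 1"
      by (intro mult_mono Suc.IH) auto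
    finally show ?case by simp
  qed auto
  then show ?thesis by (simp add: field_simps)
qed

lemma W_tendsto_0: "W \<longlonglongrightarrow> 0"
proof -
  have "(\<lambda>n. W n ^ 2) \<longlonglongrightarrow> 0"
  proof (rule tendsto_sandwich[OF _ _ tendsto_const])
    show "(\<lambda>n. 1 / (2 * real n + 1)) \<longlonglongrightarrow> 0" by real_asymp
  qed (auto simp: W_square_bound)
  then show ?thesis by simp
qed

subsection \<open>Wilf-Zeilberger pairs for the series of Bauer and Ramanujan\<close>

text \<open>The sum of \<open>G\<close> along the row \<open>k = 0\<close> equals its sum along any other row, and as \<open>k\<close> grows
  only the term \<open>n = 0\<close> survives.\<close>

lemma WZ_sums:
  fixes F G :: "nat \<Rightarrow> nat \<Rightarrow> real"
  assumes WZ: "\<And>n k. F (Suc n) k - F n k = G n (Suc k) - G n k"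
    and F_0: "\<And>k. F 0 k = 0"
    and F_lim: "\<And>k. (\<lambda>n. F n k) \<longlonglongrightarrow> 0"
    and G_bound: "\<And>n k. k \<ge> K \<Longrightarrow> \<bar>G n k\<bar> \<le> M n"
    and M: "summable M"
    and G_lim: "\<And>n. n > 0 \<Longrightarrow> (\<lambda>k. G n k) \<longlonglongrightarrow> 0"
    and G_0: "(\<lambda>k. G 0 k) \<longlonglongrightarrow> L"
  shows "(\<lambda>n. G n 0) sums L"
proof -
  \<comment> \<open>Summing \<open>WZ\<close> over \<open>n < N\<close> telescopes to
    \<open>F N k\<close> because \<open>F 0 k = 0\<close>, so moving up one row changes the partial
    sum by \<open>F N k\<close>.\<close>
  have tele: "(\<Sum>n<N. G n 0) = (\<Sum>n<N. G n k) - (\<Sum>j<k. F N j)" for N k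
  proof (induction k)
    case (Suc k)
    have "F N k = (\<Sum>n<N. F (Suc n) k - F n k)"
      by (subst sum_lessThan_telescope) (simp add: F_0)
    then have "F N k = (\<Sum>n<N. G n (Suc k)) - (\<Sum>n<N. G n k)"
      by (simp add: WZ sum_subtractf)
    with Suc show ?case by simp
  qed auto
  have summ: "summable (\<lambda>n. G n k)" if "k \<ge> K" for k
    by (rule summable_comparison_test'[OF M, of 0]) (use G_bound that in auto)
  have row: "(\<lambda>n. G n 0) sums (\<Sum>n. G n k)" if "k \<ge> K" for k
  proof -
    \<comment> \<open>For fixed \<open>k\<close> the correction is a finite sum of null sequences,
      so row 0 converges, possibly only conditionally, to the sum of row \<open>k\<close>.\<close>
    have "(\<lambda>N. (\<Sum>n<N. G n k) - (\<Sum>j<k. F N j)) \<longlonglongrightarrow> (\<Sum>n. G n k) - (\<Sum>j<k. 0)"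
      by (intro tendsto_intros summable_LIMSEQ summ that F_lim)
    then show ?thesis by (simp add: sums_def tele[of _ k])
  qed
  have "((\<lambda>k. \<Sum>n. G n k) \<longlongrightarrow> (\<Sum>n. if n = 0 then L else 0)) sequentially"
  proof (rule tannerys_theorem[THEN conjunct2, THEN conjunct2])
    show "((\<lambda>k. G n k) \<longlongrightarrow> (if n = 0 then L else 0)) sequentially" for n
      using G_lim G_0 by auto
    show "\<forall>\<^sub>F (n, k) in sequentially \<times>\<^sub>F sequentially. norm (G n k) \<le> M n"
      unfolding eventually_prod_sequentially
      using G_bound by auto
  qed (use M in auto)
  then have "(\<lambda>k. \<Sum>n. G n k) \<longlonglongrightarrow> L"
    using suminf_finite[of "{0}" "\<lambda>n. if n = (0::nat) then L else 0"] by simp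
  moreover have "\<forall>\<^sub>F k in sequentially. (\<Sum>n. G n k) = (\<Sum>n. G n 0)"
    using row by (intro eventually_sequentiallyI[of K]) (metis sums_unique)
  ultimately have "(\<lambda>k::nat. \<Sum>n. G n 0) \<longlonglongrightarrow> L"
    by (rule Lim_transform_eventually)
  then have "(\<Sum>n. G n 0) = L" by (simp add: LIMSEQ_const_iff)
  with row[of K] show ?thesis by (metis order_refl sums_unique)
qed

section \<open>Hypergeometric terms that deform the classical summands\<close>

text \<open>Both members of the pair are linear multiples of this one term: \<open>G\<close> carries
  the weight \<open>4 n + 2 k + 1\<close> and \<open>F\<close> the weight
  \<open>2 n\<close>.\<close>

definition bauer_term :: "nat \<Rightarrow> nat \<Rightarrow> real" where
  "bauer_term n k = (- 1) ^ n * pochhammer (1/2) (n + k) * pochhammer (1/2) n ^ 2 * pochhammer (1/2) k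
     / (fact n * fact (n + k) ^ 2)"

lemma bauer_term_Suc_left:
  "bauer_term (Suc n) k = - bauer_term n k *
     ((real n + 1/2) ^ 2 * (real n + real k + 1/2) / ((real n + 1) * (real n + real k + 1) ^ 2))"
  by (simp add: bauer_term_def pochhammer_Suc power_mult_distrib divide_simps) (simp add: algebra_simps)

lemma bauer_term_Suc_right:
  "bauer_term n (Suc k) = bauer_term n k *
     ((real k + 1/2) * (real n + real k + 1/2) / (real n + real k + 1) ^ 2)"
  by (simp add: bauer_term_def pochhammer_Suc power_mult_distrib divide_simps) (simp add: algebra_simps)

lemma bauer_term_0_left: "bauer_term 0 k = W k ^ 2"
  by (simp add: bauer_term_def W_def power2_eq_square)

lemma bauer_term_0_right: "bauer_term n 0 = (- 1) ^ n * W n ^ 3"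
  by (simp add: bauer_term_def W_def power2_eq_square power3_eq_cube)

text \<open>The weights are \<open>6 n + 4 k + 1\<close> for \<open>G\<close> and \<open>4 n\<close>
  for \<open>F\<close>; \<open>(1 / 4) ^ k\<close> balances the growth of
  \<open>pochhammer (1/2) (n + 2 * k)\<close> against \<open>fact (n + k) ^ 2\<close>.\<close>

definition eighth_term :: "nat \<Rightarrow> nat \<Rightarrow> real" where
  "eighth_term n k = (- 1 / 8) ^ n * (1 / 4) ^ k * pochhammer (1/2) n ^ 2 * pochhammer (1/2) (n + 2 * k)
     / (fact n * fact (n + k) ^ 2)"

lemma eighth_term_Suc_left:
  "eighth_term (Suc n) k = - eighth_term n k *
     ((real n + 1/2) ^ 2 * (real n + 2 * real k + 1/2) / (8 * (real n + 1) * (real n + real k + 1) ^ 2))"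
  by (simp add: eighth_term_def pochhammer_Suc power_mult_distrib divide_simps) (simp add: algebra_simps)

lemma eighth_term_Suc_right:
  "eighth_term n (Suc k) = eighth_term n k *
     ((real n + 2 * real k + 1/2) * (real n + 2 * real k + 3/2) / (4 * (real n + real k + 1) ^ 2))"
  by (simp add: eighth_term_def pochhammer_Suc power_mult_distrib divide_simps) (simp add: algebra_simps)

lemma eighth_term_0_left: "eighth_term 0 k = W (2 * k) * W k"
  using fact_double[of k, where ?'a = real] pochhammer_pos[of "1/2 :: real" k]
  by (simp add: eighth_term_def W_def power2_eq_square power_mult power_divide divide_simps)

lemma eighth_term_0_right: "eighth_term n 0 = (- 1 / 8) ^ n * W n ^ 3"
  by (simp add: eighth_term_def W_def power2_eq_square power3_eq_cube)

text \<open>Row \<open>k = 0\<close> belongs to a series in powers of \<open>1/4\<close>; the series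
  in powers of \<open>1/64\<close> is read off the diagonal \<open>k = n\<close>.\<close>

definition quarter_term :: "nat \<Rightarrow> nat \<Rightarrow> real" where
  "quarter_term n k = (1 / 4) ^ n * pochhammer (1/2) n ^ 3 * pochhammer (1/2) k ^ 2
     / (fact n * fact (n + k) ^ 2)"

lemma quarter_term_Suc_left:
  "quarter_term (Suc n) k = quarter_term n k *
     ((real n + 1/2) ^ 3 / (4 * (real n + 1) * (real n + real k + 1) ^ 2))"
  by (simp add: quarter_term_def pochhammer_Suc power_mult_distrib divide_simps) (simp add: algebra_simps)

lemma quarter_term_Suc_right:
  "quarter_term n (Suc k) = quarter_term n k * ((real k + 1/2) ^ 2 / (real n + real k + 1) ^ 2)"
  by (simp add: quarter_term_def pochhammer_Suc power_mult_distrib divide_simps) (simp add: algebra_simps)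

lemma quarter_term_0_left: "quarter_term 0 k = W k ^ 2"
  by (simp add: quarter_term_def W_def power_divide)

lemma quarter_term_diag: "quarter_term n n = W n ^ 3 / 64 ^ n"
proof -
  have "(64::real) ^ n = 4 ^ n * (4 ^ n * 4 ^ n)" "(2::real) ^ (n + n) = 4 ^ n"
    by (simp_all add: power_add flip: power_mult_distrib)
  then show ?thesis
  using fact_double[of n, where ?'a = real]
  by (simp add: quarter_term_def W_def power2_eq_square power3_eq_cube power_mult power_divide mult_2 divide_simps)
qed

text \<open>After division by the common term the two ratio lemmas leave rational functions, and
  clearing denominators gives a polynomial identity. The next two pairs work alike.\<close>

lemma bauer_WZ:
  "2 * real (Suc n) * bauer_term (Suc n) k - 2 * real n * bauer_term n k
    = (4 * real n + 2 * real (Suc k) + 1) * bauer_term n (Suc k) - (4 * real n + 2 * real k + 1) * bauer_term n k"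
  by (simp add: bauer_term_Suc_left bauer_term_Suc_right power2_eq_square divide_simps) algebra

lemma eighth_WZ:
  "4 * real (Suc n) * eighth_term (Suc n) k - 4 * real n * eighth_term n k
    = (6 * real n + 4 * real (Suc k) + 1) * eighth_term n (Suc k) - (6 * real n + 4 * real k + 1) * eighth_term n k"
  by (simp add: eighth_term_Suc_left eighth_term_Suc_right power2_eq_square divide_simps) algebra

lemma quarter_WZ:
  "8 * real (Suc n) * quarter_term (Suc n) k - 8 * real n * quarter_term n k
    = (6 * real n + 4 * real (Suc k) + 1) * quarter_term n (Suc k) - (6 * real n + 4 * real k + 1) * quarter_term n k"
  by (simp add: quarter_term_Suc_left quarter_term_Suc_right power2_eq_square power3_eq_cube divide_simps) algebra

text \<open>The \<open>F\<close> part equals \<open>(2 n + 1) / 4\<close> times the diagonal term,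
  and \<open>10 n + 1 + (2 n + 1) / 4 = (42 n + 5) / 4\<close>.\<close>

lemma quarter_diag_step:
  "(6 * real n + 4 * real n + 1) * quarter_term n n + 8 * real (Suc n) * quarter_term (Suc n) n
    = (42 * real n + 5) / 4 * W n ^ 3 / 64 ^ n"
  unfolding quarter_term_Suc_left quarter_term_diag
  by (simp add: power2_eq_square power3_eq_cube divide_simps) algebra

section \<open>Majorants uniform in \<open>k\<close>, and the three classical series\<close>

text \<open>The factor \<open>W k ^ 2\<close> absorbs the growth in \<open>k\<close> of the linear
  weight of \<open>G\<close>.\<close>

lemma W_square_weight: "(a + 2 * real k + 1) * W k ^ 2 \<le> a + 1" if "a \<ge> 0"
proof -
  have "(a + 2 * real k + 1) * W k ^ 2 \<le> (a + 2 * real k + 1) * (1 / (2 * real k + 1))"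
    using that by (intro mult_left_mono W_square_bound) auto
  also have "\<dots> \<le> a + 1"
    using that by (simp add: divide_simps algebra_simps)
  finally show ?thesis .
qed

lemma binomial_ge_Suc: "real ((n + k) choose n) \<ge> real k + 1" if "n > 0"
proof -
  have "(Suc k) choose k \<le> (n + k) choose k"
    using that by (intro binomial_right_mono) auto
  then show ?thesis
    using binomial_symmetric[of k "n + k"] by simp
qed

text \<open>One \<open>fact (n + k)\<close> is split into \<open>fact n * fact k\<close> times a
  binomial coefficient, which supplies decay in \<open>n\<close> and in \<open>k\<close>.\<close>

lemma abs_bauer_term:
  "\<bar>bauer_term n k\<bar> = W (n + k) * W n ^ 2 * W k / real ((n + k) choose n)"
  by (simp add: bauer_term_def W_def binomial_fact abs_mult power_abs pochhammer_nonneg power2_eq_square divide_simps)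

lemma bauer_term_bound: "\<bar>bauer_term n k\<bar> \<le> W k ^ 2 * W n ^ 2 / real ((n + k) choose n)"
proof -
  have "W (n + k) * W n ^ 2 * W k \<le> W k * W n ^ 2 * W k"
    by (intro mult_mono W_antimono) (auto simp: W_pos less_imp_le)
  then show ?thesis
    unfolding abs_bauer_term by (intro divide_right_mono) (auto simp: power2_eq_square mult_ac)
qed

lemma weighted_bauer_bound:
  "\<bar>(4 * real n + 2 * real k + 1) * bauer_term n k\<bar>
    \<le> (4 * real n + 1) / (2 * real n + 1) / real ((n + k) choose n)"
proof -
  have "\<bar>(4 * real n + 2 * real k + 1) * bauer_term n k\<bar>
      \<le> (4 * real n + 2 * real k + 1) * (W k ^ 2 * W n ^ 2 / real ((n + k) choose n))"
    unfolding abs_mult by (intro mult_mono bauer_term_bound) auto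
  also have "\<dots> = ((4 * real n + 2 * real k + 1) * W k ^ 2) * W n ^ 2 / real ((n + k) choose n)"
    by simp
  also have "\<dots> \<le> (4 * real n + 1) * (1 / (2 * real n + 1)) / real ((n + k) choose n)"
    by (intro divide_right_mono mult_mono W_square_weight W_square_bound) auto
  finally show ?thesis by simp
qed

lemma bauer_series: "(\<lambda>n. (4 * real n + 1) * (- 1) ^ n * W n ^ 3) sums (2 / pi)"
proof -
  have "(\<lambda>n. (4 * real n + 2 * real 0 + 1) * bauer_term n 0) sums (2 / pi)"
  \<comment> \<open>Row 0 converges only conditionally. From \<open>k = 2\<close> on the binomial
    coefficient is at least \<open>(n + 1) ^ 2 / 2\<close>, which makes the majorant
    summable.\<close>
  proof (rule WZ_sums[where F = "\<lambda>n k. 2 * real n * bauer_term n k"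
        and G = "\<lambda>n k. (4 * real n + 2 * real k + 1) * bauer_term n k"
        and M = "\<lambda>n. 4 * inverse (real (Suc n)) ^ 2" and K = 2])
    show "(\<lambda>n. 2 * real n * bauer_term n k) \<longlonglongrightarrow> 0" for k
    proof (rule Lim_null_comparison[OF always_eventually W_tendsto_0], rule allI)
      fix n
      have "norm (2 * real n * bauer_term n k)
          = W (n + k) * (2 * real n * W n ^ 2) * (W k / real ((n + k) choose n))"
        by (simp add: abs_mult abs_bauer_term)
      also have "\<dots> \<le> W n * 1 * 1"
      proof (intro mult_mono W_antimono)
        show "2 * real n * W n ^ 2 \<le> 1"
          using W_square_weight[of 0 n] by (simp add: algebra_simps) (smt (verit) zero_le_power2)
        have "real ((n + k) choose n) \<ge> 1"
          by (simp add: Suc_leI)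
        then show "W k / real ((n + k) choose n) \<le> 1"
          using W_le_1[of k] by (simp add: divide_simps)
      qed (auto simp: W_pos less_imp_le)
      finally show "norm (2 * real n * bauer_term n k) \<le> W n" by simp
    qed
    show "\<bar>(4 * real n + 2 * real k + 1) * bauer_term n k\<bar> \<le> 4 * inverse (real (Suc n)) ^ 2" if "k \<ge> 2" for n k
    proof -
      have "(n + 2) choose n \<le> (n + k) choose n"
        using that by (intro binomial_right_mono) auto
      moreover have "real ((n + 2) choose n) = (real n + 2) * (real n + 1) / 2"
        by (simp add: binomial_fact divide_simps mult.commute add.commute)
      ultimately have "(real n + 2) * (real n + 1) / 2 \<le> real ((n + k) choose n)"
        by (metis of_nat_le_iff)
      moreover have "(real n + 1) ^ 2 / 2 \<le> (real n + 2) * (real n + 1) / 2"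
        by (simp add: power2_eq_square algebra_simps)
      ultimately have "(real n + 1) ^ 2 / 2 \<le> real ((n + k) choose n)"
        by (rule order_trans[rotated])
      then have "(4 * real n + 1) / (2 * real n + 1) / real ((n + k) choose n) \<le> 2 / ((real n + 1) ^ 2 / 2)"
        by (intro frac_le) (auto simp: divide_simps)
      also have "2 / ((real n + 1) ^ 2 / 2) = 4 * inverse (real (Suc n)) ^ 2"
        by (simp add: power_inverse field_simps)
      finally show ?thesis
        using weighted_bauer_bound[of n k] by linarith
    qed
    show "summable (\<lambda>n. 4 * inverse (real (Suc n)) ^ 2)"
      using inverse_power_summable[of 2, where ?'a = real]
      by (intro summable_mult) (subst summable_Suc_iff, simp add: power_inverse)
    show "(\<lambda>k. (4 * real n + 2 * real k + 1) * bauer_term n k) \<longlonglongrightarrow> 0" if "n > 0" for n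
    proof (rule Lim_null_comparison[OF always_eventually], rule allI)
      show "(\<lambda>k. 2 / (real k + 1)) \<longlonglongrightarrow> 0" by real_asymp
      show "norm ((4 * real n + 2 * real k + 1) * bauer_term n k) \<le> 2 / (real k + 1)" for k
      proof -
        have "(4 * real n + 1) / (2 * real n + 1) / real ((n + k) choose n) \<le> 2 / (real k + 1)"
          using binomial_ge_Suc[OF that, of k] by (intro frac_le) (auto simp: divide_simps)
        with weighted_bauer_bound[of n k] show ?thesis by simp
      qed
    qed
    show "(\<lambda>k. (4 * real 0 + 2 * real k + 1) * bauer_term 0 k) \<longlonglongrightarrow> 2 / pi"
      using W_square_limit by (simp add: bauer_term_0_left)
  qed (use bauer_WZ in auto)
  then show ?thesis by (simp add: bauer_term_0_right mult_ac)
qed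

text \<open>Induction on \<open>n\<close>: by \<open>n + 2 k + 1/2 \<le> 2 (n + k + 1)\<close> the
  ratio is at most \<open>1/4\<close> times \<open>(n + 1) / (n + k + 1)\<close>, and the latter is
  exactly the ratio of the reciprocal binomial coefficients.\<close>

lemma eighth_term_bound: "\<bar>eighth_term n k\<bar> \<le> (1 / 4) ^ n * W k ^ 2 / real ((n + k) choose n)"
proof (induction n)
  case 0
  have "W (2 * k) * W k \<le> W k * W k"
    by (intro mult_right_mono W_antimono) (auto simp: W_pos less_imp_le)
  then show ?case
    by (simp add: eighth_term_0_left abs_mult W_pos less_imp_le power2_eq_square)
next
  case (Suc n)
  let ?r = "(real n + 1/2) ^ 2 * (real n + 2 * real k + 1/2) / (8 * (real n + 1) * (real n + real k + 1) ^ 2)"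
  have "?r \<le> (real n + 1) ^ 2 * (2 * (real n + real k + 1)) / (8 * (real n + 1) * (real n + real k + 1) ^ 2)"
    by (intro divide_right_mono mult_mono power_mono) auto
  also have "\<dots> = (1 / 4) * ((real n + 1) / (real n + real k + 1))"
    by (simp add: power2_eq_square divide_simps) algebra
  finally have r: "?r \<le> (1 / 4) * ((real n + 1) / (real n + real k + 1))" .
  have "real (Suc n) * real ((Suc n + k) choose Suc n) = (real n + real k + 1) * real ((n + k) choose n)"
    using arg_cong[OF Suc_times_binomial[of n "n + k"], of real]
    by (simp add: algebra_simps del: binomial_Suc_Suc)
  then have b: "real ((Suc n + k) choose Suc n) = (real n + real k + 1) / (real n + 1) * real ((n + k) choose n)"
    by (simp add: field_simps)
  have "\<bar>eighth_term (Suc n) k\<bar> = \<bar>eighth_term n k\<bar> * ?r"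
    unfolding eighth_term_Suc_left by (subst abs_mult) (simp add: abs_mult)
  also have "\<dots> \<le> ((1 / 4) ^ n * W k ^ 2 / real ((n + k) choose n)) * ((1 / 4) * ((real n + 1) / (real n + real k + 1)))"
    by (intro mult_mono Suc.IH r) auto
  also have "\<dots> = (1 / 4) ^ Suc n * W k ^ 2 / real ((Suc n + k) choose Suc n)"
    unfolding b by simp
  finally show ?case .
qed

lemma quarter_term_bound: "\<bar>quarter_term n k\<bar> \<le> (1 / 4) ^ n * W k ^ 2 / real ((n + k) choose n)"
proof -
  let ?b = "real ((n + k) choose n)"
  have b: "?b \<ge> 1" by (simp add: Suc_leI)
  have "\<bar>quarter_term n k\<bar> = (1 / 4) ^ n * W k ^ 2 / ?b * (W n ^ 3 * (1 / ?b))"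
    by (simp add: quarter_term_def W_def binomial_fact abs_mult power_abs pochhammer_nonneg
        power2_eq_square power3_eq_cube divide_simps)
  also have "W n ^ 3 * (1 / ?b) \<le> 1 * 1"
    using b W_le_1[of n] W_pos[of n] by (intro mult_mono power_le_one) (auto simp: less_imp_le)
  then have "(1 / 4) ^ n * W k ^ 2 / ?b * (W n ^ 3 * (1 / ?b)) \<le> (1 / 4) ^ n * W k ^ 2 / ?b * 1"
    by (intro mult_left_mono) auto
  finally show ?thesis by simp
qed

text \<open>Serves \<open>eighth_term\<close> and \<open>quarter_term\<close> together: they share
  this majorant and the weight of \<open>G\<close>.\<close>

lemma geometric_weight:
  assumes "\<bar>t\<bar> \<le> (1 / 4) ^ n * W k ^ 2 / real ((n + k) choose n)"
  shows "\<bar>(6 * real n + 4 * real k + 1) * t\<bar> \<le> 6 * (real (Suc n) * (1 / 4) ^ n) / real ((n + k) choose n)"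
proof -
  have "\<bar>(6 * real n + 4 * real k + 1) * t\<bar>
      \<le> (6 * real n + 4 * real k + 1) * ((1 / 4) ^ n * W k ^ 2 / real ((n + k) choose n))"
    unfolding abs_mult by (intro mult_mono assms) auto
  also have "\<dots> = (6 * real n + 4 * real k + 1) * W k ^ 2 * ((1 / 4) ^ n / real ((n + k) choose n))"
    by simp
  also have "(6 * real n + 4 * real k + 1) * W k ^ 2 \<le> 2 * ((3 * real n + 2 * real k + 1) * W k ^ 2)"
    by (simp add: algebra_simps)
  then have "(6 * real n + 4 * real k + 1) * W k ^ 2 \<le> 6 * real (Suc n)"
    using W_square_weight[of "3 * real n" k] by simp
  then have "(6 * real n + 4 * real k + 1) * W k ^ 2 * ((1 / 4) ^ n / real ((n + k) choose n))
     \<le> 6 * real (Suc n) * ((1 / 4) ^ n / real ((n + k) choose n))"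
    by (intro mult_right_mono) auto
  finally show ?thesis by (simp add: algebra_simps)
qed

lemma geometric_weight_bound:
  assumes "\<bar>t\<bar> \<le> (1 / 4) ^ n * W k ^ 2 / real ((n + k) choose n)"
  shows "\<bar>(6 * real n + 4 * real k + 1) * t\<bar> \<le> 6 * (real (Suc n) * (1 / 4) ^ n)"
proof -
  have "6 * (real (Suc n) * (1 / 4) ^ n) / real ((n + k) choose n) \<le> 6 * (real (Suc n) * (1 / 4) ^ n) / 1"
    by (intro divide_left_mono) (auto simp: Suc_leI)
  with geometric_weight[OF assms] show ?thesis by simp
qed

lemma geometric_weight_limit:
  assumes "\<And>k. \<bar>t k\<bar> \<le> (1 / 4) ^ n * W k ^ 2 / real ((n + k) choose n)" "n > 0"
  shows "(\<lambda>k. (6 * real n + 4 * real k + 1) * t k) \<longlonglongrightarrow> 0"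
proof (rule Lim_null_comparison[OF always_eventually], rule allI)
  show "(\<lambda>k. 6 * (real (Suc n) * (1 / 4) ^ n) / (real k + 1)) \<longlonglongrightarrow> 0" by real_asymp
  show "norm ((6 * real n + 4 * real k + 1) * t k) \<le> 6 * (real (Suc n) * (1 / 4) ^ n) / (real k + 1)" for k
  proof -
    have "6 * (real (Suc n) * (1 / 4) ^ n) / real ((n + k) choose n) \<le> 6 * (real (Suc n) * (1 / 4) ^ n) / (real k + 1)"
      using binomial_ge_Suc[OF assms(2), of k] by (intro divide_left_mono) auto
    with geometric_weight[OF assms(1), of k] show ?thesis by simp
  qed
qed

lemma geometric_weight_summable: "summable (\<lambda>n. 6 * (real (Suc n) * (1 / 4) ^ n))"
  using geometric_deriv_sums[of "1 / 4 :: real"] by (intro summable_mult) (auto simp: sums_iff)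

lemma W_square_limit': "(\<lambda>n. (4 * real n + 1) * W n ^ 2) \<longlonglongrightarrow> 4 / pi"
proof -
  have "(\<lambda>n. 2 * ((2 * real n + 1) * W n ^ 2) - W n ^ 2) \<longlonglongrightarrow> 2 * (2 / pi) - 0 ^ 2"
    by (intro tendsto_intros W_square_limit W_tendsto_0)
  then show ?thesis by (simp add: algebra_simps)
qed

lemma series_eighth: "(\<lambda>n. (6 * real n + 1) * (- 1 / 8) ^ n * W n ^ 3) sums (2 * sqrt 2 / pi)"
proof -
  have "(\<lambda>n. (6 * real n + 4 * real 0 + 1) * eighth_term n 0) sums (2 * sqrt 2 / pi)"
  proof (rule WZ_sums[where F = "\<lambda>n k. 4 * real n * eighth_term n k"
        and G = "\<lambda>n k. (6 * real n + 4 * real k + 1) * eighth_term n k"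
        and M = "\<lambda>n. 6 * (real (Suc n) * (1 / 4) ^ n)" and K = 0])
    show "(\<lambda>n. 4 * real n * eighth_term n k) \<longlonglongrightarrow> 0" for k
    proof (rule Lim_null_comparison[OF always_eventually summable_LIMSEQ_zero[OF geometric_weight_summable]], rule allI)
      fix n
      \<comment> \<open>Since \<open>4 n \<le> 6 n + 4 k + 1\<close>, the bound for \<open>G\<close>
        also controls \<open>F\<close>.\<close>
      have "norm (4 * real n * eighth_term n k) \<le> \<bar>(6 * real n + 4 * real k + 1) * eighth_term n k\<bar>"
        by (simp add: abs_mult mult_right_mono)
      with geometric_weight_bound[OF eighth_term_bound[of n k]]
      show "norm (4 * real n * eighth_term n k) \<le> 6 * (real (Suc n) * (1 / 4) ^ n)" by linarith
    qed
    \<comment> \<open>\<open>(4 k + 1) * W (2 k) * W k\<close> is the geometric mean of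
      \<open>(4 k + 1) * W (2 k) ^ 2\<close> and \<open>(4 k + 1) * W k ^ 2\<close>, whose limits
      are \<open>2 / pi\<close> and \<open>4 / pi\<close>.\<close>
    have "(\<lambda>k. (2 * real (2 * k) + 1) * W (2 * k) ^ 2) \<longlonglongrightarrow> 2 / pi"
      by (rule LIMSEQ_subseq_LIMSEQ[OF W_square_limit, of "\<lambda>k. 2 * k", unfolded o_def]) (simp add: strict_mono_def)
    then have "(\<lambda>k. sqrt (((2 * real (2 * k) + 1) * W (2 * k) ^ 2) * ((4 * real k + 1) * W k ^ 2)))
        \<longlonglongrightarrow> sqrt (2 / pi * (4 / pi))"
      by (intro tendsto_intros W_square_limit')
    moreover have "sqrt (((2 * real (2 * k) + 1) * W (2 * k) ^ 2) * ((4 * real k + 1) * W k ^ 2))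
        = (4 * real 0 + 4 * real k + 1) * eighth_term 0 k" for k
      by (rule real_sqrt_unique)
         (auto simp: eighth_term_0_left power2_eq_square W_pos less_imp_le algebra_simps)
    moreover have "sqrt (2 / pi * (4 / pi)) = 2 * sqrt 2 / pi"
      by (rule real_sqrt_unique) (auto simp: power2_eq_square)
    ultimately show "(\<lambda>k. (6 * real 0 + 4 * real k + 1) * eighth_term 0 k) \<longlonglongrightarrow> 2 * sqrt 2 / pi"
      by simp
  qed (use eighth_WZ geometric_weight_bound[OF eighth_term_bound] geometric_weight_limit[OF eighth_term_bound]
       geometric_weight_summable in auto)
  then show ?thesis by (simp add: eighth_term_0_right mult_ac)
qed

text \<open>The discrete one-form with components \<open>G\<close> and \<open>F\<close> is closed, so summing it along the staircase
  \<open>(n, n), (n + 1, n), (n + 1, n + 1)\<close> up to \<open>(N, N)\<close> gives the same value as summing \<open>G\<close> along the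
  row \<open>k = N\<close>.\<close>

lemma series_64th: "(\<lambda>n. (42 * real n + 5) * W n ^ 3 / 64 ^ n) sums (16 / pi)"
proof -
  let ?G = "\<lambda>n k. (6 * real n + 4 * real k + 1) * quarter_term n k"
  let ?F = "\<lambda>n k. 8 * real n * quarter_term n k"
  let ?D = "\<lambda>n. (42 * real n + 5) / 4 * W n ^ 3 / 64 ^ n"
  have tele: "(\<Sum>n<N. ?D n) = (\<Sum>n<N. ?G n N)" for N
  proof (induction N)
    case (Suc N)
    have "(\<Sum>n<N. ?G n (Suc N)) = (\<Sum>n<N. ?G n N + (?F (Suc n) N - ?F n N))"
      by (intro sum.cong refl) (use quarter_WZ in \<open>simp add: algebra_simps\<close>)
    also have "\<dots> = (\<Sum>n<N. ?G n N) + ?F N N"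
      by (subst sum.distrib, subst sum_lessThan_telescope) simp
    finally have "(\<Sum>n<Suc N. ?G n (Suc N)) = (\<Sum>n<N. ?D n) + ?F N N + ?G N (Suc N)"
      by (simp only: sum.lessThan_Suc Suc.IH)
    \<comment> \<open>The pair relation at \<open>(N, N)\<close> turns
      \<open>?F N N + ?G N (Suc N)\<close> into \<open>?G N N + ?F (Suc N) N\<close>, the other way
      round the unit square.\<close>
    also have "\<dots> = (\<Sum>n<N. ?D n) + ?D N"
      using quarter_WZ[of N N] quarter_diag_step[of N] by linarith
    finally show ?case by simp
  qed auto
  \<comment> \<open>The length of the sum and the row index grow together; cutting off at
    \<open>N\<close> inside an infinite sum allows a dominated passage to the limit.\<close>
  have "((\<lambda>N. \<Sum>n. if n < N then ?G n N else 0) \<longlongrightarrow> (\<Sum>n. if n = 0 then 4 / pi else 0)) sequentially"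
  proof (rule tannerys_theorem[THEN conjunct2, THEN conjunct2])
    show "((\<lambda>N. if n < N then ?G n N else 0) \<longlongrightarrow> (if n = 0 then 4 / pi else 0)) sequentially" for n
    proof (rule Lim_transform_eventually)
      show "?G n \<longlonglongrightarrow> (if n = 0 then 4 / pi else 0)"
        using geometric_weight_limit[OF quarter_term_bound, of n] W_square_limit'
        by (auto simp: quarter_term_0_left)
      show "\<forall>\<^sub>F N in sequentially. ?G n N = (if n < N then ?G n N else 0)"
        using eventually_gt_at_top[of n] by eventually_elim auto
    qed
    show "\<forall>\<^sub>F (n, N) in sequentially \<times>\<^sub>F sequentially.
        norm (if n < N then ?G n N else 0) \<le> 6 * (real (Suc n) * (1 / 4) ^ n)"
      using geometric_weight_bound[OF quarter_term_bound] by (intro always_eventually) auto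
  qed (use geometric_weight_summable in auto)
  moreover have "(\<Sum>n. if n < N then ?G n N else 0) = (\<Sum>n<N. ?D n)" for N
    unfolding tele by (subst suminf_finite[of "{..<N}"]) auto
  moreover have "(\<Sum>n. if n = (0::nat) then 4 / pi else 0) = 4 / pi"
    using suminf_finite[of "{0}" "\<lambda>n. if n = (0::nat) then 4 / pi else 0"] by simp
  ultimately have "?D sums (4 / pi)"
    by (simp add: sums_def)
  from sums_mult[OF this, of 4] show ?thesis by simp
qed

subsection \<open>Euler transformation of the generating function\<close>

lemma gchoose_minus_half: "((- 1 / 2 :: real) gchoose n) = (- 1) ^ n * W n"
  by (simp add: gbinomial_pochhammer W_def)

text \<open>First use of Vandermonde: \<open>W k\<close> is the binomial coefficient of
  \<open>k - 1/2\<close> over \<open>k\<close>, with upper entry split as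
  \<open>- 1/2 + k\<close>.\<close>

lemma W_eq_sum: "W k = (\<Sum>j=0..k. real (k choose j) * ((- 1 / 2) gchoose j))"
proof -
  have "W k = (- 1 / 2 + real k) gchoose k"
    by (simp add: gbinomial_pochhammer' W_def)
  also have "\<dots> = (\<Sum>j=0..k. ((- 1 / 2) gchoose j) * (real k gchoose (k - j)))"
    by (rule gbinomial_Vandermonde[symmetric])
  also have "\<dots> = (\<Sum>j=0..k. real (k choose j) * ((- 1 / 2) gchoose j))"
  proof (intro sum.cong refl)
    fix j assume "j \<in> {0..k}"
    then show "((- 1 / 2) gchoose j) * (real k gchoose (k - j)) = real (k choose j) * ((- 1 / 2) gchoose j)"
      using binomial_symmetric[of j k] by (simp flip: binomial_gbinomial)
  qed
  finally show ?thesis .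
qed

text \<open>Trinomial revision pulls out the factor depending on \<open>j\<close> alone. Vandermonde
  then gives the upper entry \<open>- (j + 1)\<close>, and negating it leaves an ordinary binomial
  coefficient.\<close>

lemma sum_choose_gchoose_minus_half:
  assumes "j \<le> n"
  shows "(\<Sum>k=0..n. real (k choose j) * ((- 1 / 2) gchoose k) * ((- 1 / 2) gchoose (n - k)))
    = (- 1) ^ (n - j) * ((- 1 / 2) gchoose j) * real (n choose j)"
proof -
  let ?b = "\<lambda>k. (- 1 / 2 :: real) gchoose k"
  have "(\<Sum>k=0..n. real (k choose j) * ?b k * ?b (n - k)) = (\<Sum>k=j..n. real (k choose j) * ?b k * ?b (n - k))"
    by (rule sum.mono_neutral_right) auto
  also have "\<dots> = (\<Sum>k=j..n. ?b j * ((- 1 / 2 - real j) gchoose (k - j)) * ?b (n - k))"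
  proof (intro sum.cong refl)
    fix k assume "k \<in> {j..n}"
    then have "?b k * (real k gchoose j) = ?b j * ((- 1 / 2 - real j) gchoose (k - j))"
      by (intro gbinomial_trinomial_revision) auto
    then show "real (k choose j) * ?b k * ?b (n - k) = ?b j * ((- 1 / 2 - real j) gchoose (k - j)) * ?b (n - k)"
      by (simp add: binomial_gbinomial mult_ac)
  qed
  also have "\<dots> = (\<Sum>i=0..n-j. ?b j * ((- 1 / 2 - real j) gchoose i) * ?b (n - j - i))"
    using assms by (intro sum.reindex_bij_witness[of _ "\<lambda>i. i + j" "\<lambda>k. k - j"]) (auto simp: add.commute)
  also have "\<dots> = ?b j * ((- 1 / 2 - real j + - 1 / 2) gchoose (n - j))"
    unfolding gbinomial_Vandermonde[symmetric] sum_distrib_left by (simp add: mult_ac)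
  also have "((- 1 / 2 - real j + - 1 / 2) gchoose (n - j)) = (- 1) ^ (n - j) * (real n gchoose (n - j))"
    using assms by (subst gbinomial_negated_upper) (simp add: of_nat_diff)
  also have "real n gchoose (n - j) = real (n choose j)"
    using assms binomial_symmetric[of j n] by (simp flip: binomial_gbinomial)
  finally show ?thesis by (simp add: mult_ac)
qed

lemma convolution_W_eq_alternating:
  "(\<Sum>k=0..n. W k ^ 2 * W (n - k)) = (\<Sum>j=0..n. real (n choose j) * (- 1) ^ j * W j ^ 2)"
proof -
  let ?b = "\<lambda>k. (- 1 / 2 :: real) gchoose k"
  have "(\<Sum>k=0..n. W k ^ 2 * W (n - k))
      = (\<Sum>k=0..n. (\<Sum>j=0..n. real (k choose j) * ?b j) * ((- 1) ^ n * ?b k * ?b (n - k)))"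
  \<comment> \<open>Only one factor of \<open>W k ^ 2\<close> is expanded; the other is paired with
    \<open>W (n - k)\<close>. The range of \<open>j\<close> extends to \<open>n\<close> because
    \<open>k choose j\<close> vanishes for \<open>j > k\<close>.\<close>
  proof (intro sum.cong refl)
    fix k assume k: "k \<in> {0..n}"
    have "W k = (\<Sum>j=0..n. real (k choose j) * ?b j)"
      unfolding W_eq_sum[of k] using k by (intro sum.mono_neutral_left) auto
    moreover have "W k * W (n - k) = (- 1) ^ n * ?b k * ?b (n - k)"
    proof -
      have "(- 1 :: real) ^ n = (- 1) ^ k * (- 1) ^ (n - k)"
        using k by (simp flip: power_add)
      then show ?thesis
        unfolding gchoose_minus_half by (simp add: uminus_power_if)
    qed
    ultimately show "W k ^ 2 * W (n - k)
        = (\<Sum>j=0..n. real (k choose j) * ?b j) * ((- 1) ^ n * ?b k * ?b (n - k))"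
      by (metis mult.assoc power2_eq_square)
  qed
  also have "\<dots> = (\<Sum>j=0..n. \<Sum>k=0..n. real (k choose j) * ?b j * ((- 1) ^ n * ?b k * ?b (n - k)))"
    unfolding sum_distrib_right by (rule sum.swap)
  also have "\<dots> = (\<Sum>j=0..n. (- 1) ^ n * ?b j * (\<Sum>k=0..n. real (k choose j) * ?b k * ?b (n - k)))"
    unfolding sum_distrib_left by (intro sum.cong refl) (simp add: mult_ac)
  also have "\<dots> = (\<Sum>j=0..n. real (n choose j) * (- 1) ^ j * W j ^ 2)"
  proof (intro sum.cong refl)
    fix j assume j: "j \<in> {0..n}"
    then have "(- 1 :: real) ^ n * (- 1) ^ (n - j) = (- 1) ^ j"
      by (simp flip: power_add) (simp add: uminus_power_if)
    then show "(- 1) ^ n * ?b j * (\<Sum>k=0..n. real (k choose j) * ?b k * ?b (n - k))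
        = real (n choose j) * (- 1) ^ j * W j ^ 2"
      using j
      by (subst sum_choose_gchoose_minus_half, simp)
         (unfold gchoose_minus_half, auto simp: uminus_power_if power2_eq_square split: if_splits)
  qed
  finally show ?thesis .
qed

section \<open>Generating function of the normalised coefficients\<close>

definition sun_coeff :: "nat \<Rightarrow> real" where
  "sun_coeff n = real ((2 * n) choose n) * P n 4 / 64 ^ n"

text \<open>At the argument 4 the power \<open>4 ^ (n - k)\<close> gives every summand of
  \<open>P n 4\<close> the same factor \<open>16 ^ n\<close>; the outer binomial coefficient
  supplies the remaining \<open>4 ^ n\<close> of \<open>64 ^ n\<close>.\<close>

lemma sun_coeff_eq_convolution: "sun_coeff n = W n * (\<Sum>k=0..n. W k ^ 2 * W (n - k))"
proof -
  have "P n 4 = (\<Sum>k=0..n. 16 ^ n * (W k ^ 2 * W (n - k)))"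
    unfolding P_def
  proof (intro sum.cong refl)
    fix k assume "k \<in> {0..n}"
    then have "(16 :: real) ^ n = 16 ^ k * 16 ^ (n - k)"
      by (simp flip: power_add)
    also have "\<dots> = (4 ^ k) ^ 2 * (4 ^ (n - k) * 4 ^ (n - k))"
      by (simp add: power2_eq_square flip: power_mult_distrib)
    finally show "real ((2 * k) choose k) ^ 2 * real ((2 * (n - k)) choose (n - k)) * 4 ^ (n - k)
        = 16 ^ n * (W k ^ 2 * W (n - k))"
      by (simp only: central_binomial_eq_W) (simp add: power_mult_distrib)
  qed
  moreover have "(64 :: real) ^ n = 4 ^ n * 16 ^ n"
    by (simp flip: power_mult_distrib)
  ultimately show ?thesis
    by (simp add: sun_coeff_def central_binomial_eq_W flip: sum_distrib_left)
qed

lemma sun_coeff_eq_alternating: "sun_coeff n = W n * (\<Sum>k=0..n. real (n choose k) * (- 1) ^ k * W k ^ 2)"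
  by (simp add: sun_coeff_eq_convolution convolution_W_eq_alternating)

lemma abs_sun_coeff_le: "\<bar>sun_coeff n\<bar> \<le> real n + 1"
proof -
  have "W k ^ 2 * W (n - k) \<le> 1 * 1" for k
    by (intro mult_mono W_le_1 power_le_one) (auto simp: W_pos less_imp_le)
  then have "(\<Sum>k=0..n. W k ^ 2 * W (n - k)) \<le> (\<Sum>k=0..n. 1)"
    by (intro sum_mono) simp
  then have "sun_coeff n \<le> 1 * (real n + 1)"
    unfolding sun_coeff_eq_convolution
    by (intro mult_mono W_le_1) (auto intro!: sum_nonneg simp: W_pos less_imp_le)
  moreover have "sun_coeff n \<ge> 0"
    unfolding sun_coeff_eq_convolution by (auto intro!: mult_nonneg_nonneg sum_nonneg simp: W_pos less_imp_le)
  ultimately show ?thesis by simp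
qed

lemma summable_linear_growth:
  fixes a :: "nat \<Rightarrow> real"
  assumes "\<And>n. \<bar>a n\<bar> \<le> real n + 1" "\<bar>y\<bar> < 1"
  shows "summable (\<lambda>n. a n * y ^ n)"
proof (rule summable_comparison_test')
  show "summable (\<lambda>n. of_nat (Suc n) * \<bar>y\<bar> ^ n)"
    using geometric_deriv_sums[of "\<bar>y\<bar>"] assms(2) by (auto simp: sums_iff)
  show "norm (a n * y ^ n) \<le> of_nat (Suc n) * \<bar>y\<bar> ^ n" for n
    using assms(1)[of n] by (auto simp: abs_mult power_abs intro!: mult_right_mono)
qed

lemma sums_times_index:
  fixes a :: "nat \<Rightarrow> real"
  assumes "(\<lambda>n. diffs a n * y ^ n) sums D"
  shows "(\<lambda>n. real n * a n * y ^ n) sums (y * D)"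
proof -
  have "(\<lambda>n. real (Suc n) * a (Suc n) * y ^ Suc n) sums (y * D)"
    using sums_mult[OF assms, of y] by (simp add: diffs_def mult_ac)
  then show ?thesis
    by (subst (asm) sums_Suc_iff) simp
qed

definition W_cube_series :: "real \<Rightarrow> real" where
  "W_cube_series x = (\<Sum>n. W n ^ 3 * x ^ n)"

lemma summable_W_cube: "\<bar>x\<bar> < 1 \<Longrightarrow> summable (\<lambda>n. W n ^ 3 * x ^ n)"
proof (rule summable_linear_growth)
  show "\<bar>W n ^ 3\<bar> \<le> real n + 1" for n
    using power_le_one[of "W n" 3] W_pos[of n] W_le_1[of n] by (simp add: less_imp_le)
qed

lemma negative_binomial_sums:
  assumes "\<bar>y\<bar> < (1::real)"
  shows "(\<lambda>m. pochhammer (real k + 1/2) m / fact m * y ^ m) sums (1 / ((1 - y) ^ k * sqrt (1 - y)))"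
proof -
  have "(\<lambda>m. ((- (real k + 1/2)) gchoose m) * (- y) ^ m) sums (1 + (- y)) powr (- (real k + 1/2))"
    using assms by (intro gen_binomial_real) auto
  moreover have "((- (real k + 1/2)) gchoose m) * (- y) ^ m = pochhammer (real k + 1/2) m / fact m * y ^ m" for m
  proof -
    have "(- 1) ^ m * (- y) ^ m = y ^ m"
      by (simp flip: power_mult_distrib)
    moreover have "((- (real k + 1/2)) gchoose m) * (- y) ^ m
        = ((- 1) ^ m * (- y) ^ m) * (pochhammer (real k + 1/2) m / fact m)"
      by (simp add: gbinomial_pochhammer add.commute)
    ultimately show ?thesis by simp
  qed
  moreover have "(1 + (- y)) powr (- (real k + 1/2)) = 1 / ((1 - y) ^ k * sqrt (1 - y))"
    using assms
    by (subst powr_minus, subst powr_add) (simp add: powr_realpow powr_half_sqrt inverse_eq_divide)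
  ultimately show ?thesis by simp
qed

lemma abs_euler_less_1: "\<bar>y\<bar> < 1/2 \<Longrightarrow> \<bar>- y / (1 - y)\<bar> < (1::real)"
  by (simp add: abs_divide)

text \<open>The \<open>k\<close>-th term on the right is expanded by the binomial series for
  exponent \<open>- (k + 1/2)\<close>. The double series \<open>f\<close> summed by rows gives the
  right side, and by antidiagonals the left.\<close>

lemma sun_coeff_sums:
  assumes y: "\<bar>y\<bar> < 1/2"
  shows "(\<lambda>n. sun_coeff n * y ^ n) sums (W_cube_series (- y / (1 - y)) / sqrt (1 - y))"
proof -
  let ?e = "\<lambda>k m. pochhammer (real k + 1/2) m / fact m"
  define f where "f = (\<lambda>(k, m). W k ^ 3 * (- y) ^ k * (?e k m * y ^ m))"
  \<comment> \<open>The row sums of \<open>norm (f (k, m))\<close> are governed by powers of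
    \<open>r\<close>; the condition \<open>\<bar>y\<bar> < 1/2\<close> is what makes
    \<open>r < 1\<close>.\<close>
  define r where "r = \<bar>y\<bar> / (1 - \<bar>y\<bar>)"
  have r: "0 \<le> r" "r < 1" using y by (auto simp: r_def field_simps)
  have e: "?e k m \<ge> 0" for k m by (simp add: pochhammer_nonneg)
  have abs: "((\<lambda>m. norm (f (k, m))) has_sum (W k ^ 3 * r ^ k / sqrt (1 - \<bar>y\<bar>))) UNIV" for k
  proof -
    have "(\<lambda>m. W k ^ 3 * \<bar>y\<bar> ^ k * (?e k m * \<bar>y\<bar> ^ m))
        sums (W k ^ 3 * \<bar>y\<bar> ^ k * (1 / ((1 - \<bar>y\<bar>) ^ k * sqrt (1 - \<bar>y\<bar>))))"
      using y by (intro sums_mult negative_binomial_sums) auto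
    then have "((\<lambda>m. W k ^ 3 * \<bar>y\<bar> ^ k * (?e k m * \<bar>y\<bar> ^ m))
        has_sum (W k ^ 3 * \<bar>y\<bar> ^ k * (1 / ((1 - \<bar>y\<bar>) ^ k * sqrt (1 - \<bar>y\<bar>))))) UNIV"
      by (rule sums_nonneg_imp_has_sum) (intro mult_nonneg_nonneg e, auto simp: W_pos less_imp_le)
    moreover have "norm (f (k, m)) = W k ^ 3 * \<bar>y\<bar> ^ k * (?e k m * \<bar>y\<bar> ^ m)" for m
      using pochhammer_nonneg[of "real k + 1/2" m] W_pos[of k] by (simp add: f_def abs_mult power_abs)
    ultimately show ?thesis
      by (simp add: r_def power_divide)
  qed
  have f: "f summable_on UNIV \<times> UNIV"
  proof (rule abs_summable_summable, rule summable_on_SigmaI[OF abs])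
    have "summable (\<lambda>k. W k ^ 3 * r ^ k / sqrt (1 - \<bar>y\<bar>))"
      using r by (intro summable_divide summable_W_cube) auto
    then show "(\<lambda>k. W k ^ 3 * r ^ k / sqrt (1 - \<bar>y\<bar>)) summable_on UNIV"
      using r y by (intro summable_nonneg_imp_summable_on) (auto simp: W_pos less_imp_le)
  qed auto
  have row: "((\<lambda>m. f (k, m)) has_sum (W k ^ 3 * (- y / (1 - y)) ^ k / sqrt (1 - y))) UNIV" for k
  proof (rule norm_summable_imp_has_sum)
    show "summable (\<lambda>m. norm (f (k, m)))"
      using abs[of k] by (auto dest: has_sum_imp_sums simp: sums_iff)
    have "(\<lambda>m. W k ^ 3 * (- y) ^ k * (?e k m * y ^ m))
        sums (W k ^ 3 * (- y) ^ k * (1 / ((1 - y) ^ k * sqrt (1 - y))))"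
      using y by (intro sums_mult negative_binomial_sums) auto
    then show "(\<lambda>m. f (k, m)) sums (W k ^ 3 * (- y / (1 - y)) ^ k / sqrt (1 - y))"
      unfolding power_divide by (simp add: f_def)
  qed
  obtain S where S: "(f has_sum S) (UNIV \<times> UNIV)"
    using f by (auto simp: summable_on_def)
  have "(\<lambda>k. W k ^ 3 * (- y / (1 - y)) ^ k / sqrt (1 - y)) sums S"
    by (rule has_sum_imp_sums, rule has_sum_SigmaD[OF S row])
  moreover have "\<bar>- y / (1 - y)\<bar> < 1"
    by (rule abs_euler_less_1[OF y])
  then have "(\<lambda>k. W k ^ 3 * (- y / (1 - y)) ^ k / sqrt (1 - y)) sums (W_cube_series (- y / (1 - y)) / sqrt (1 - y))"
    unfolding W_cube_series_def by (intro sums_divide summable_sums summable_W_cube)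
  ultimately have S_eq: "S = W_cube_series (- y / (1 - y)) / sqrt (1 - y)"
    by (rule sums_unique2)
  \<comment> \<open>Regrouping by \<open>n = k + m\<close>.\<close>
  have "((\<lambda>(n, k). f (k, n - k)) has_sum S) (Sigma UNIV (\<lambda>n. {0..n}))"
    using S by (subst has_sum_reindex_bij_witness[of _ "\<lambda>(k, m). (k + m, k)" "\<lambda>(n, k). (k, n - k)" "UNIV \<times> UNIV" f _ S]) auto
  then have "(\<lambda>n. \<Sum>k=0..n. f (k, n - k)) sums S"
    by (intro has_sum_imp_sums, elim has_sum_SigmaD) (auto intro: has_sum_finite)
  moreover have "(\<Sum>k=0..n. f (k, n - k)) = sun_coeff n * y ^ n" for n
    unfolding sun_coeff_eq_alternating sum_distrib_left sum_distrib_right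
  proof (intro sum.cong refl)
    fix k assume k: "k \<in> {0..n}"
    have "pochhammer (1/2 :: real) n = pochhammer (1/2) k * pochhammer (real k + 1/2) (n - k)"
      using k pochhammer_product[of k n "1/2 :: real"] by (simp add: add.commute)
    then have "W k * ?e k (n - k) = W n * real (n choose k)"
      using k by (simp add: W_def binomial_fact)
    moreover have "W k ^ 3 * ?e k (n - k) = (W k * ?e k (n - k)) * W k ^ 2"
      by (simp add: power2_eq_square power3_eq_cube)
    ultimately have 1: "W k ^ 3 * ?e k (n - k) = W n * real (n choose k) * W k ^ 2"
      by (simp only:)
    have 2: "(- y) ^ k * y ^ (n - k) = (- 1) ^ k * y ^ n"
      using k by (simp add: power_minus[of y] flip: power_add)
    have "f (k, n - k) = (W k ^ 3 * ?e k (n - k)) * ((- y) ^ k * y ^ (n - k))"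
      by (simp add: f_def)
    also have "\<dots> = W n * (real (n choose k) * (- 1) ^ k * W k ^ 2) * y ^ n"
      unfolding 1 2 by simp
    finally show "f (k, n - k) = W n * (real (n choose k) * (- 1) ^ k * W k ^ 2) * y ^ n" .
  qed
  ultimately show ?thesis by (simp add: S_eq)
qed

text \<open>Applies \<open>y d/dy\<close> to \<open>sun_coeff_sums\<close>. As
  \<open>y dX/dy = X / (1 - y)\<close> and \<open>1 / sqrt (1 - y)\<close> contributes
  \<open>y / (2 (1 - y))\<close>, the index \<open>n\<close> becomes
  \<open>(n + y / 2) / (1 - y)\<close>.\<close>

lemma index_sun_coeff_sums:
  assumes y: "\<bar>y\<bar> < 1/2" and X: "X = - y / (1 - y)"
    and S: "(\<lambda>n. (\<alpha> * (real n + y / 2) / (1 - y) + \<beta>) * W n ^ 3 * X ^ n) sums S"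
  shows "(\<lambda>n. (\<alpha> * real n + \<beta>) * sun_coeff n * y ^ n) sums (S / sqrt (1 - y))"
proof -
  have X1: "\<bar>X\<bar> < 1"
    unfolding X by (rule abs_euler_less_1[OF y])
  have y1: "1 - y > 0" using y by auto
  have le: "\<bar>W n ^ 3\<bar> \<le> real n + 1" for n
    using power_le_one[of "W n" 3] W_pos[of n] W_le_1[of n] by (simp add: less_imp_le)
  define D where "D = (\<Sum>n. diffs (\<lambda>n. W n ^ 3) n * X ^ n)"
  have dB: "(W_cube_series has_real_derivative D) (at X)"
    unfolding W_cube_series_def D_def by (rule termdiffs_strong'[where K = 1]) (use X1 summable_W_cube in auto)
  have D: "(\<lambda>n. diffs (\<lambda>n. W n ^ 3) n * X ^ n) sums D"
    unfolding D_def by (intro summable_sums termdiff_converges[where K = 1]) (use X1 summable_W_cube in auto)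
  have "((\<lambda>y. W_cube_series (- y / (1 - y)) / sqrt (1 - y)) has_real_derivative
      (D * (- 1 / (1 - y) ^ 2)) / sqrt (1 - y) + W_cube_series X * (1 / (2 * (1 - y) * sqrt (1 - y)))) (at y)"
  proof -
    have "((\<lambda>y. - y / (1 - y)) has_real_derivative (- 1 / (1 - y) ^ 2)) (at y)"
      using y1 by (auto intro!: derivative_eq_intros simp: divide_simps power2_eq_square)
    then have "((\<lambda>y. W_cube_series (- y / (1 - y))) has_real_derivative D * (- 1 / (1 - y) ^ 2)) (at y)"
      using dB by (intro DERIV_chain2[of W_cube_series]) (auto simp: X)
    moreover have "((\<lambda>y. 1 / sqrt (1 - y)) has_real_derivative 1 / (2 * (1 - y) * sqrt (1 - y))) (at y)"
      using y1 by (auto intro!: derivative_eq_intros simp: divide_simps)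
    ultimately have "((\<lambda>y. W_cube_series (- y / (1 - y)) * (1 / sqrt (1 - y))) has_real_derivative
        D * (- 1 / (1 - y) ^ 2) * (1 / sqrt (1 - y)) + 1 / (2 * (1 - y) * sqrt (1 - y)) * W_cube_series (- y / (1 - y))) (at y)"
      by (rule DERIV_mult)
    then show ?thesis by (simp add: X mult.commute)
  qed
  then have "(\<lambda>n. diffs sun_coeff n * y ^ n) sums
      ((D * (- 1 / (1 - y) ^ 2)) / sqrt (1 - y) + W_cube_series X * (1 / (2 * (1 - y) * sqrt (1 - y))))"
    by (intro termdiffs_sums_strong[where K = "1/2" and f = "\<lambda>y. W_cube_series (- y / (1 - y)) / sqrt (1 - y)"] sun_coeff_sums)
       (use y in auto)
  from sums_add[OF sums_mult[OF sums_times_index[OF this], of \<alpha>] sums_mult[OF sun_coeff_sums[OF y], of \<beta>]]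
  have "(\<lambda>n. (\<alpha> * real n + \<beta>) * sun_coeff n * y ^ n) sums
      (\<alpha> * (y * ((D * (- 1 / (1 - y) ^ 2)) / sqrt (1 - y) + W_cube_series X * (1 / (2 * (1 - y) * sqrt (1 - y)))))
        + \<beta> * (W_cube_series X / sqrt (1 - y)))"
    by (simp add: X algebra_simps)
  also have "\<alpha> * (y * ((D * (- 1 / (1 - y) ^ 2)) / sqrt (1 - y) + W_cube_series X * (1 / (2 * (1 - y) * sqrt (1 - y)))))
        + \<beta> * (W_cube_series X / sqrt (1 - y))
      = (\<alpha> / (1 - y) * (X * D) + (\<alpha> * y / (2 * (1 - y)) + \<beta>) * W_cube_series X) / sqrt (1 - y)"
  proof -
    \<comment> \<open>The identity holds for independent \<open>u\<close>, \<open>s\<close> and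
      \<open>b\<close>, so the square root stays opaque to the algebra.\<close>
    have "\<alpha> * (y * ((D * (- 1 / u ^ 2)) / s + b * (1 / (2 * u * s)))) + \<beta> * (b / s)
        = (\<alpha> / u * (- y / u * D) + (\<alpha> * y / (2 * u) + \<beta>) * b) / s" if "u > 0" "s > 0" for u s b :: real
      using that by (simp add: power2_eq_square field_simps)
    from this[of "1 - y" "sqrt (1 - y)" "W_cube_series X"] show ?thesis
      using y1 by (simp add: X)
  qed
  also have "\<alpha> / (1 - y) * (X * D) + (\<alpha> * y / (2 * (1 - y)) + \<beta>) * W_cube_series X = S"
  proof (rule sums_unique2[OF _ S])
    have "(\<lambda>n. W n ^ 3 * X ^ n) sums W_cube_series X"
      unfolding W_cube_series_def using X1 by (intro summable_sums summable_W_cube)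
    from sums_add[OF sums_mult[OF sums_times_index[OF D], of "\<alpha> / (1 - y)"]
        sums_mult[OF this, of "\<alpha> * y / (2 * (1 - y)) + \<beta>"]]
    show "(\<lambda>n. (\<alpha> * (real n + y / 2) / (1 - y) + \<beta>) * W n ^ 3 * X ^ n) sums
        (\<alpha> / (1 - y) * (X * D) + (\<alpha> * y / (2 * (1 - y)) + \<beta>) * W_cube_series X)"
      using y1 by (simp add: add_divide_distrib algebra_simps)
  qed
  finally show ?thesis .
qed

section \<open>Abel's limit theorem and the boundary point \<open>y = 1/2\<close>\<close>

text \<open>Summation by parts with the tails \<open>r n\<close> gives
  \<open>x * (\<Sum>n. a n * x ^ n) = suminf a - (1 - x) * R x\<close>, and the last term vanishes
  because the tails tend to 0.\<close>

lemma Abel_limit: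
  fixes a :: "nat \<Rightarrow> real"
  assumes a: "summable a"
  shows "((\<lambda>x. \<Sum>n. a n * x ^ n) \<longlongrightarrow> suminf a) (at_left 1)"
proof -
  define r where "r = (\<lambda>n. \<Sum>i. a (i + n))"
  define R where "R = (\<lambda>x. \<Sum>n. r n * x ^ n)"
  have r_lim: "r \<longlonglongrightarrow> 0"
    unfolding r_def by (rule suminf_exist_split2[OF a])
  have r_Suc: "a n = r n - r (Suc n)" for n
    using suminf_split_head[of "\<lambda>i. a (i + n)"] summable_ignore_initial_segment[OF a, of n]
    by (simp add: r_def)
  obtain C where C: "\<And>n. \<bar>r n\<bar> \<le> C"
    using convergent_imp_Bseq[of r] r_lim by (auto simp: convergent_def Bseq_def)
  have sum_r: "summable (\<lambda>n. r n * x ^ n)" if "0 \<le> x" "x < 1" for x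
    by (rule summable_comparison_test'[of "\<lambda>n. C * x ^ n" 0])
       (use that C in \<open>auto simp: abs_mult intro!: mult_right_mono summable_mult summable_geometric\<close>)
  have eq: "(\<Sum>n. a n * x ^ n) = (suminf a - (1 - x) * R x) / x" if x: "0 < x" "x < 1" for x
  proof -
    have s: "(\<lambda>n. r n * x ^ n) sums R x"
      unfolding R_def using x by (intro summable_sums sum_r) auto
    then have "(\<lambda>n. r (Suc n) * x ^ Suc n) sums (R x - r 0)"
      by (subst sums_Suc_iff) simp
    from sums_diff[OF sums_mult[OF s, of x] this]
    have "(\<lambda>n. x * (a n * x ^ n)) sums (x * R x - (R x - r 0))"
      by (simp add: r_Suc algebra_simps)
    from sums_mult[OF this, of "1 / x"] have "(\<lambda>n. a n * x ^ n) sums ((x * R x - (R x - r 0)) / x)"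
      using x by simp
    then show ?thesis
      by (simp add: sums_iff r_def algebra_simps)
  qed
  have "((\<lambda>x. (1 - x) * R x) \<longlongrightarrow> 0) (at_left 1)"
  proof (rule tendstoI)
    fix e :: real assume e: "e > 0"
    obtain N where N: "\<And>n. n \<ge> N \<Longrightarrow> \<bar>r n\<bar> \<le> e / 2"
      using LIMSEQ_D[OF r_lim, of "e / 2"] e by (auto intro: less_imp_le)
    define M where "M = (\<Sum>n<N. \<bar>r n\<bar>)"
    have M: "M \<ge> 0" unfolding M_def by (simp add: sum_nonneg)
    \<comment> \<open>The first \<open>N\<close> tails contribute at most \<open>M\<close>; the rest
      are at most \<open>e / 2\<close>, and the factor \<open>1 - x\<close> cancels their geometric
      sum.\<close>
    have bound: "\<bar>(1 - x) * R x\<bar> \<le> e / 2 + (1 - x) * M" if x: "0 < x" "x < 1" for x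
    proof -
      have g: "(\<lambda>n. (if n \<in> {..<N} then \<bar>r n\<bar> else 0) + e / 2 * x ^ n) sums (M + e / 2 * (1 / (1 - x)))"
        unfolding M_def using x by (intro sums_add sums_mult sums_If_finite_set geometric_sums) auto
      have b: "norm (r n * x ^ n) \<le> (if n \<in> {..<N} then \<bar>r n\<bar> else 0) + e / 2 * x ^ n" for n
      proof (cases "n < N")
        case True
        have "\<bar>r n * x ^ n\<bar> \<le> \<bar>r n\<bar> * 1"
          unfolding abs_mult using x by (intro mult_left_mono) (auto simp: power_le_one)
        with True e x show ?thesis by (simp add: add_increasing2)
      next
        case False
        with N[of n] x show ?thesis by (auto simp: abs_mult intro!: mult_right_mono)
      qed
      have s: "(\<lambda>n. r n * x ^ n) sums R x"
        unfolding R_def using x by (intro summable_sums sum_r) auto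
      have "norm (R x) \<le> M + e / 2 * (1 / (1 - x))"
        using b by (rule norm_sums_le[OF s g])
      then have "(1 - x) * \<bar>R x\<bar> \<le> (1 - x) * (M + e / 2 * (1 / (1 - x)))"
        using x by (intro mult_left_mono) auto
      also have "\<dots> = e / 2 + (1 - x) * M"
        using x by (simp add: field_simps)
      finally show ?thesis using x by (simp add: abs_mult)
    qed
    have "\<forall>\<^sub>F x in at_left 1. e / 2 + (1 - x) * M < e"
    proof (rule order_tendstoD)
      show "((\<lambda>x. e / 2 + (1 - x) * M) \<longlongrightarrow> e / 2 + (1 - 1) * M) (at_left 1)"
        by (intro tendsto_intros)
    qed (use e in auto)
    moreover have "\<forall>\<^sub>F x in at_left 1. (x :: real) \<in> {0<..<1}"
      by (rule eventually_at_leftI[of 0]) auto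
    ultimately show "\<forall>\<^sub>F x in at_left 1. dist ((1 - x) * R x) 0 < e"
    proof eventually_elim
      case (elim x)
      with bound[of x] show ?case by simp
    qed
  qed
  then have "((\<lambda>x. (suminf a - (1 - x) * R x) / x) \<longlongrightarrow> (suminf a - 0) / 1) (at_left 1)"
    by (intro tendsto_intros) auto
  then have "((\<lambda>x. (suminf a - (1 - x) * R x) / x) \<longlongrightarrow> suminf a) (at_left 1)"
    by simp
  moreover have "\<forall>\<^sub>F x in at_left 1. (suminf a - (1 - x) * R x) / x = (\<Sum>n. a n * x ^ n)"
    by (rule eventually_at_leftI[of 0]) (use eq in auto)
  ultimately show ?thesis
    by (rule Lim_transform_eventually)
qed

lemma index_sun_coeff_sums_half: "(\<lambda>n. real n * sun_coeff n * (1/2) ^ n) sums (sqrt 2 / pi)"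
proof -
  let ?g = "\<lambda>y. \<Sum>n. (real n * sun_coeff n) * y ^ n"
  let ?A = "\<lambda>x. \<Sum>n. ((4 * real n + 1) * (- 1) ^ n * W n ^ 3) * x ^ n"
  let ?A' = "\<lambda>x. \<Sum>n. ((- 1) ^ n * W n ^ 3) * x ^ n"
  let ?x = "\<lambda>y::real. y / (1 - y)"
  have summ: "summable (\<lambda>n. (real n * sun_coeff n) * y ^ n)" if "\<bar>y\<bar> < 1" for y
  proof -
    have "summable (\<lambda>n. diffs sun_coeff n * y ^ n)"
      by (rule termdiff_converges[where K = 1]) (use that summable_linear_growth abs_sun_coeff_le in auto)
    from sums_times_index[OF summable_sums[OF this]] show ?thesis
      by (simp add: sums_iff)
  qed
  have g_lim: "(?g \<longlongrightarrow> ?g (1/2)) (at_left (1/2))"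
  proof -
    have "isCont ?g (1/2)"
      by (rule isCont_powser[of _ "3/4"]) (use summ in auto)
    then show ?thesis
      by (simp add: isCont_def filterlim_at_split)
  qed
  have A_sum: "summable (\<lambda>n. (4 * real n + 1) * (- 1) ^ n * W n ^ 3)"
    using bauer_series by (simp add: sums_iff)
  have A'_sum: "summable (\<lambda>n. (- 1) ^ n * W n ^ 3)"
  proof (rule summable_Leibniz'(1))
    show "(\<lambda>n. W n ^ 3) \<longlonglongrightarrow> 0"
      using tendsto_power[OF W_tendsto_0, of 3] by simp
    show "W (Suc n) ^ 3 \<le> W n ^ 3" for n
      by (intro power_mono W_antimono) (auto simp: W_pos less_imp_le)
  qed (auto simp: W_pos less_imp_le)
  have x_lim: "filterlim ?x (at_left 1) (at_left (1/2))"
    unfolding filterlim_at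
  proof
    have "(?x \<longlongrightarrow> (1/2) / (1 - 1/2)) (at_left (1/2))"
      by (intro tendsto_intros) auto
    then show "(?x \<longlongrightarrow> 1) (at_left (1/2))" by simp
    show "\<forall>\<^sub>F y in at_left (1/2). ?x y \<in> {..<1} \<and> ?x y \<noteq> 1"
      by (rule eventually_at_leftI[of 0]) (auto simp: field_simps)
  qed
  \<comment> \<open>Uses \<open>n + y / 2 = (4 n + 1) / 4 + (y / 2 - 1 / 4)\<close>: the first part
    is Bauer's weight, and the second vanishes in the limit \<open>y = 1/2\<close>, where
    \<open>?A'\<close> stays bounded.\<close>
  have eq: "(1 / 4 * ?A (?x y) + (y / 2 - 1 / 4) * ?A' (?x y)) / (1 - y) / sqrt (1 - y) = ?g y"
    if y: "y \<in> {0<..<1/2}" for y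
  proof -
    define x where "x = ?x y"
    have x: "0 < x" "x < 1" using y by (auto simp: x_def field_simps)
    have W3: "\<bar>(- 1) ^ n * W n ^ 3\<bar> \<le> real n + 1" for n
      using power_le_one[of "W n" 3] W_pos[of n] W_le_1[of n] by (simp add: abs_mult less_imp_le)
    have A'_x: "summable (\<lambda>n. ((- 1) ^ n * W n ^ 3) * x ^ n)"
      using x by (intro summable_linear_growth W3) auto
    have A_x: "summable (\<lambda>n. ((4 * real n + 1) * (- 1) ^ n * W n ^ 3) * x ^ n)"
      using powser_inside[of "\<lambda>n. (4 * real n + 1) * (- 1) ^ n * W n ^ 3" 1 x] A_sum x by simp
    from sums_divide[OF sums_add[OF sums_mult[OF summable_sums[OF A_x], of "1/4"]
        sums_mult[OF summable_sums[OF A'_x], of "y / 2 - 1 / 4"]], of "1 - y"]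
    have "(\<lambda>n. (1 * (real n + y / 2) / (1 - y) + 0) * W n ^ 3 * (- x) ^ n)
        sums ((1 / 4 * ?A x + (y / 2 - 1 / 4) * ?A' x) / (1 - y))"
      by (rule sums_cong[THEN iffD1, rotated]) (simp add: power_minus[of x] algebra_simps add_divide_distrib diff_divide_distrib)
    from index_sun_coeff_sums[OF _ _ this] show ?thesis
      using y by (simp add: x_def sums_iff)
  qed
  have "((\<lambda>y. (1 / 4 * ?A (?x y) + (y / 2 - 1 / 4) * ?A' (?x y)) / (1 - y) / sqrt (1 - y)) \<longlongrightarrow>
      (1 / 4 * (2 / pi) + ((1/2) / 2 - 1 / 4) * (\<Sum>n. (- 1) ^ n * W n ^ 3)) / (1 - 1/2) / sqrt (1 - 1/2)) (at_left (1/2))"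
    using filterlim_compose[OF Abel_limit[OF A_sum] x_lim] filterlim_compose[OF Abel_limit[OF A'_sum] x_lim] bauer_series
    by (intro tendsto_intros) (auto simp: sums_iff)
  moreover have "(1 / 4 * (2 / pi) + ((1/2) / 2 - 1 / 4) * (\<Sum>n. (- 1) ^ n * W n ^ 3)) / (1 - 1/2) / sqrt (1 - 1/2)
      = sqrt 2 / pi"
    by (simp add: real_sqrt_divide field_simps)
  ultimately have "((\<lambda>y. (1 / 4 * ?A (?x y) + (y / 2 - 1 / 4) * ?A' (?x y)) / (1 - y) / sqrt (1 - y)) \<longlongrightarrow> sqrt 2 / pi)
      (at_left (1/2))"
    by simp
  moreover have "\<forall>\<^sub>F y in at_left (1/2). (1 / 4 * ?A (?x y) + (y / 2 - 1 / 4) * ?A' (?x y)) / (1 - y) / sqrt (1 - y) = ?g y"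
    by (rule eventually_at_leftI[of 0]) (use eq in auto)
  ultimately have "(?g \<longlongrightarrow> sqrt 2 / pi) (at_left (1/2))"
    by (rule Lim_transform_eventually)
  then have "?g (1/2) = sqrt 2 / pi"
    using g_lim by (intro tendsto_unique[OF trivial_limit_at_left_real])
  with summ[of "1/2"] show ?thesis by (simp add: sums_iff)
qed

theorem theorem1p3:
  shows "((\<lambda>n::nat. real n / 128 ^ n * real ((2 * n) choose n) * P n 4) sums (sqrt 2 / pi))
    \<and> ((\<lambda>n::nat. (8 * real n + 1) / 576 ^ n * real ((2 * n) choose n) * P n 4) sums (9 / (2 * pi)))
    \<and> ((\<lambda>n::nat. (8 * real n + 1) / (- 4032) ^ n * real ((2 * n) choose n) * P n 4) sums (9 * sqrt 7 / (8 * pi)))"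
proof -
  \<comment> \<open>With \<open>y = 64 / m\<close> the denominators 128, 576 and -4032 correspond to
    \<open>1/2\<close>, \<open>1/9\<close> and \<open>-1/63\<close>.\<close>
  have term_eq: "(\<alpha> * real n + \<beta>) / m ^ n * real ((2 * n) choose n) * P n 4
      = (\<alpha> * real n + \<beta>) * sun_coeff n * (64 / m) ^ n" for \<alpha> \<beta> m :: real and n
    by (simp add: sun_coeff_def power_divide)
  have 1: "(\<lambda>n. (1 * real n + 0) / 128 ^ n * real ((2 * n) choose n) * P n 4) sums (sqrt 2 / pi)"
    unfolding term_eq using index_sun_coeff_sums_half by simp
  have "(\<lambda>n. (8 * (real n + (1/9) / 2) / (1 - 1/9) + 1) * W n ^ 3 * (- 1 / 8) ^ n) sums (3 / 2 * (2 * sqrt 2 / pi))"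
  proof -
    have "8 * (real n + (1/9) / 2) / (1 - 1/9) + 1 = 3 / 2 * (6 * real n + 1)" for n
      by simp
    then show ?thesis
      using sums_mult[OF series_eighth, of "3/2"] by (simp only: mult_ac)
  qed
  then have "(\<lambda>n. (8 * real n + 1) * sun_coeff n * (1/9) ^ n) sums (3 / 2 * (2 * sqrt 2 / pi) / sqrt (1 - 1/9))"
    by (rule index_sun_coeff_sums[rotated 2]) auto
  moreover have "3 / 2 * (2 * sqrt 2 / pi) / sqrt (1 - 1/9) = 9 / (2 * pi)"
  proof -
    have root: "sqrt (1 - 1/9) = 2 * sqrt 2 / 3"
      by (rule real_sqrt_unique) (auto simp: power2_eq_square)
    show ?thesis unfolding root by simp
  qed
  ultimately have 2: "(\<lambda>n. (8 * real n + 1) / 576 ^ n * real ((2 * n) choose n) * P n 4) sums (9 / (2 * pi))"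
    unfolding term_eq by simp
  have "(\<lambda>n. (8 * (real n + (- 1/63) / 2) / (1 - (- 1/63)) + 1) * W n ^ 3 * (1 / 64) ^ n) sums (3 / 16 * (16 / pi))"
  proof -
    have "8 * (real n + (- 1/63) / 2) / (1 - (- 1/63)) + 1 = 3 / 16 * (42 * real n + 5)" for n
      by (simp add: field_simps)
    then show ?thesis
      using sums_mult[OF series_64th, of "3/16"]
      by (simp only: power_inverse divide_inverse mult_ac mult_1_left)
  qed
  then have "(\<lambda>n. (8 * real n + 1) * sun_coeff n * (- 1/63) ^ n) sums (3 / 16 * (16 / pi) / sqrt (1 - (- 1/63)))"
    by (rule index_sun_coeff_sums[rotated 2]) auto
  moreover have "3 / 16 * (16 / pi) / sqrt (1 - (- 1/63)) = 9 * sqrt 7 / (8 * pi)"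
  proof -
    have root: "sqrt (1 - (- 1/63)) = 8 / (3 * sqrt 7)"
      by (rule real_sqrt_unique) (auto simp: power2_eq_square)
    show ?thesis unfolding root by simp
  qed
  ultimately have 3: "(\<lambda>n. (8 * real n + 1) / (- 4032) ^ n * real ((2 * n) choose n) * P n 4) sums (9 * sqrt 7 / (8 * pi))"
    unfolding term_eq by simp
  from 1 2 3 show ?thesis by simp
qed

end
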